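(* Let $M$ be the $2\times 3\times 4$ hypermatrix whose two slices are $$\begin{pmatrix} 1&0&0 \\ 0&1&0 \\ 0&0&1 \\ 0&0&0 \end{pmatrix},\qquad\begin{pmatrix} b_{00}&b_{01}&b_{02} \\ b_{10}&b_{11}&b_{12} \\ b_{20}&b_{21}&b_{22} \\ b_{30}&b_{31}&b_{32} \end{pmatrix}.$$ Then \begin{align*} \operatorname{Det}(M) &= b_{32}b_{31}b_{30}b_{22}b_{21}b_{12} - b_{32}^2b_{30}b_{21}^2b_{12} - b_{32}b_{31}^2b_{22}b_{20}b_{12} + b_{32}^2b_{31}b_{21}b_{20}b_{12} \\ &+ b_{31}^2b_{30}b_{21}b_{12}^2 - b_{31}^3b_{20}b_{12}^2 - b_{32}b_{31}b_{30}b_{22}^2b_{11} + b_{32}^2b_{30}b_{22}b_{21}b_{11} \\ &+ b_{32}^2b_{31}b_{22}b_{20}b_{11} - b_{32}^3b_{21}b_{20}b_{11} - b_{31}^2b_{30}b_{22}b_{12}b_{11} - b_{32}b_{31}b_{30}b_{21}b_{12}b_{11} \\ &+ 2b_{32}b_{31}^2b_{20}b_{12}b_{11} + b_{32}b_{31}b_{30}b_{22}b_{11}^2 - b_{32}^2b_{31}b_{20}b_{11}^2 + b_{32}b_{31}^2b_{22}^2b_{10} \\ &- 2b_{32}^2b_{31}b_{22}b_{21}b_{10} + b_{32}^3b_{21}^2b_{10} + b_{31}^3b_{22}b_{12}b_{10} - b_{32}b_{31}^2b_{21}b_{12}b_{10} \\ &- b_{32}b_{31}^2b_{22}b_{11}b_{10}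 + b_{32}^2b_{31}b_{21}b_{11}b_{10} + b_{32}b_{30}^2b_{22}b_{21}b_{02} - b_{32}b_{31}b_{30}b_{22}b_{20}b_{02} \\ &- b_{32}^2b_{30}b_{21}b_{20}b_{02} + b_{32}^2b_{31}b_{20}^2b_{02} + 2b_{31}b_{30}^2b_{21}b_{12}b_{02} - 2b_{31}^2b_{30}b_{20}b_{12}b_{02} \\ &- b_{31}b_{30}^2b_{22}b_{11}b_{02} + b_{32}b_{30}^2b_{21}b_{11}b_{02} + b_{31}b_{30}^2b_{11}^2b_{02} + b_{31}^2b_{30}b_{22}b_{10}b_{02} \\ &- 3b_{32}b_{31}b_{30}b_{21}b_{10}b_{02} + 2b_{32}b_{31}^2b_{20}b_{10}b_{02} - 2b_{31}^2b_{30}b_{11}b_{10}b_{02} + b_{31}^3b_{10}^2b_{02} \\ &+ b_{30}^3b_{21}b_{02}^2 - b_{31}b_{30}^2b_{20}b_{02}^2 - b_{32}b_{30}^2b_{22}^2b_{01} + 2b_{32}^2b_{30}b_{22}b_{20}b_{01} \\ &- b_{32}^3b_{20}^2b_{01} - b_{31}b_{30}^2b_{22}b_{12}b_{01} - 2b_{32}b_{30}^2b_{21}b_{12}b_{01} + 3b_{32}b_{31}b_{30}b_{20}b_{12}b_{01} \\ &+ b_{32}b_{30}^2b_{22}b_{11}b_{01} - b_{32}^2b_{30}b_{20}b_{11}b_{01} - b_{31}b_{30}^2b_{12}b_{11}b_{01} + 2b_{32}^2b_{30}b_{21}b_{10}b_{01} \\ &- 2b_{32}^2b_{31}b_{20}b_{10}b_{01}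 + b_{31}^2b_{30}b_{12}b_{10}b_{01} + b_{32}b_{31}b_{30}b_{11}b_{10}b_{01} - b_{32}b_{31}^2b_{10}^2b_{01} \\ &- b_{30}^3b_{22}b_{02}b_{01} + b_{32}b_{30}^2b_{20}b_{02}b_{01} + b_{30}^3b_{11}b_{02}b_{01} - b_{31}b_{30}^2b_{10}b_{02}b_{01} \\ &- b_{30}^3b_{12}b_{01}^2 + b_{32}b_{30}^2b_{10}b_{01}^2 + b_{32}b_{31}b_{30}b_{22}^2b_{00} - b_{32}^2b_{30}b_{22}b_{21}b_{00} \\ &- b_{32}^2b_{31}b_{22}b_{20}b_{00} + b_{32}^3b_{21}b_{20}b_{00} + b_{31}^2b_{30}b_{22}b_{12}b_{00} - b_{32}b_{31}^2b_{20}b_{12}b_{00} \\ &- b_{32}^2b_{30}b_{21}b_{11}b_{00} + b_{32}^2b_{31}b_{20}b_{11}b_{00} + b_{31}^2b_{30}b_{12}b_{11}b_{00} - b_{32}b_{31}b_{30}b_{11}^2b_{00} \\ &- b_{32}b_{31}^2b_{22}b_{10}b_{00} + b_{32}^2b_{31}b_{21}b_{10}b_{00} - b_{31}^3b_{12}b_{10}b_{00} + b_{32}b_{31}^2b_{11}b_{10}b_{00} \\ &+ b_{31}b_{30}^2b_{22}b_{02}b_{00} - 2b_{32}b_{30}^2b_{21}b_{02}b_{00} + b_{32}b_{31}b_{30}b_{20}b_{02}b_{00} - b_{31}b_{30}^2b_{11}b_{02}b_{00} \\ &+ b_{31}^2b_{30}b_{10}b_{02}b_{00} + b_{32}b_{30}^2b_{22}b_{01}b_{00}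 - b_{32}^2b_{30}b_{20}b_{01}b_{00} + 2b_{31}b_{30}^2b_{12}b_{01}b_{00} \\ &- b_{32}b_{30}^2b_{11}b_{01}b_{00} - b_{32}b_{31}b_{30}b_{10}b_{01}b_{00} - b_{32}b_{31}b_{30}b_{22}b_{00}^2 + b_{32}^2b_{30}b_{21}b_{00}^2 \\ &- b_{31}^2b_{30}b_{12}b_{00}^2 + b_{32}b_{31}b_{30}b_{11}b_{00}^2 . \end{align*}
   Context: Here the $b_{ij}$ are elements of a field $\mathbb{F}$ (or indeterminates). With $k=3$: a $2\times k\times(k+1)$ hypermatrix over $\mathbb{F}$ is an element of $\mathbb{F}^2\otimes\mathbb{F}^k\otimes\mathbb{F}^{k+1}$, written as a pair $(M_0,M_1)$ of $(k+1)\times k$ matrices over $\mathbb{F}$, with rows indexed by $0,\dots,k$ and columns by $0,\dots,k-1$. The groups $GL_2$, $GL_k$, $GL_{k+1}$ act naturally on the three tensor factors. The hyperdeterminant $\operatorname{Det}$ of format $2\times k\times(k+1)$ is the irreducible polynomial in the entries of the hypermatrix that is relatively $GL$-invariant (for each of the three groups there is an integer $l$ such that $\operatorname{Det}(g\cdot M)=\det(g)^{l}\operatorname{Det}(M)$ for all $g$ in that group and all $M$) and that vanishes at $M=(M_0,M_1)$ if and only if there are nonzero vectors $x\in\overline{\mathbb{F}}^2$, $y\in\overline{\mathbb{F}}^k$, $z\in\overline{\mathbb{F}}^{k+1}$ at which $f(x,y,z)=\sum_{p,i,j}(M_p)_{ij}x_pz_iy_j$ and all its first partial derivatives vanish. It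 is normalized by $\operatorname{Det}(I_{k,k+1})=1$, where $I_{k,k+1}$ is the hypermatrix whose first slice is $\begin{pmatrix} I_k \\ 0 \end{pmatrix}$ ($I_k$ above a zero row) and whose second slice is $\begin{pmatrix} 0 \\ I_k \end{pmatrix}$ (a zero row above $I_k$). It satisfies $\operatorname{Det}((A,B)\cdot M)=\det(A)^{k+1}\det(B)^{k}\operatorname{Det}(M)$ for $A\in GL_k(\mathbb{F})$, $B\in GL_{k+1}(\mathbb{F})$ (a theorem of Dionisi and Ottaviani), where $(A,B)\cdot(M_0,M_1)=(BM_0A^T,BM_1A^T)$. *)

theory Defs
  imports
    "HOL-Analysis.Analysis"
    "HOL-Library.Poly_Mapping"
    "HOL-Algebra.Algebraic_Closure_Type"
begin

(* frees \<open>$\<close> for vector components; the unqualified name is shadowed by Formal_Laurent_Series *)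
unbundle no Formal_Power_Series.fps_syntax

section \<open>Multivariate polynomials\<close>

type_synonym ('v, 'a) mpolynomial = "('v \<Rightarrow>\<^sub>0 nat) \<Rightarrow>\<^sub>0 'a"

definition mconst :: "'a::zero \<Rightarrow> ('v, 'a) mpolynomial" where
  "mconst c = Poly_Mapping.single 0 c"

definition mvar :: "'v \<Rightarrow> ('v, 'a::zero_neq_one) mpolynomial" where
  "mvar v = Poly_Mapping.single (Poly_Mapping.single v 1) 1"

text \<open>The value of \<open>P\<close> at the point \<open>x\<close> of a commutative ring, the coefficients of \<open>P\<close> being
  read in that ring through \<open>h\<close>, which is meant to be a ring homomorphism.\<close>

definition mpoly_eval ::
    "('a::zero \<Rightarrow> 'r::comm_ring_1) \<Rightarrow> ('v \<Rightarrow> 'r) \<Rightarrow> ('v, 'a) mpolynomial \<Rightarrow> 'r" where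
  "mpoly_eval h x P =
     (\<Sum>m\<in>Poly_Mapping.keys P.
        h (Poly_Mapping.lookup P m) *
        (\<Prod>v\<in>Poly_Mapping.keys m. x v ^ Poly_Mapping.lookup m v))"

section \<open>Hypermatrices of format 2 x 3 x 4\<close>

text \<open>A hypermatrix is a pair of slices \<open>M $ 0\<close>, \<open>M $ 1\<close>, and \<open>M $ p\<close> is a matrix with 4 rows and
  3 columns: \<open>M $ p $ i $ j\<close> is the entry of slice \<open>p\<close> in row \<open>i\<close> and column \<open>j\<close>. The elements of
  the index types \<open>2\<close>, \<open>4\<close>, \<open>3\<close> are the residues \<open>0, 1, \<dots>\<close>, so that all indices start at 0.\<close>

type_synonym 'a hypermat = "'a ^ 3 ^ 4 ^ 2"

definition hypermat_of_slices :: "'a ^ 3 ^ 4 \<Rightarrow> 'a ^ 3 ^ 4 \<Rightarrow> 'a hypermat" where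
  "hypermat_of_slices M0 M1 = (\<chi> p. if p = 0 then M0 else M1)"

text \<open>The 3 x 3 identity matrix above a zero row, and below a zero row.\<close>

definition id_over_zero :: "'a::comm_ring_1 ^ 3 ^ 4" where
  "id_over_zero = (\<chi> i j. if (i, j) \<in> {(0, 0), (1, 1), (2, 2)} then 1 else 0)"

definition zero_over_id :: "'a::comm_ring_1 ^ 3 ^ 4" where
  "zero_over_id = (\<chi> i j. if (i, j) \<in> {(1, 0), (2, 1), (3, 2)} then 1 else 0)"

definition id_hypermat :: "'a::comm_ring_1 hypermat" where
  "id_hypermat = hypermat_of_slices id_over_zero zero_over_id"

definition act_2 :: "'a::comm_ring_1 ^ 2 ^ 2 \<Rightarrow> 'a hypermat \<Rightarrow> 'a hypermat" where
  "act_2 g M = (\<chi> p i j. \<Sum>q\<in>UNIV. g $ p $ q * M $ q $ i $ j)"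

definition act_3 :: "'a::comm_ring_1 ^ 3 ^ 3 \<Rightarrow> 'a hypermat \<Rightarrow> 'a hypermat" where
  "act_3 A M = (\<chi> p. M $ p ** transpose A)"

definition act_4 :: "'a::comm_ring_1 ^ 4 ^ 4 \<Rightarrow> 'a hypermat \<Rightarrow> 'a hypermat" where
  "act_4 B M = (\<chi> p. B ** M $ p)"

definition trilinear_form ::
    "'a::comm_ring_1 hypermat \<Rightarrow> 'a ^ 2 \<Rightarrow> 'a ^ 3 \<Rightarrow> 'a ^ 4 \<Rightarrow> 'a" where
  "trilinear_form M x y z =
     (\<Sum>p\<in>UNIV. \<Sum>i\<in>UNIV. \<Sum>j\<in>UNIV. M $ p $ i $ j * x $ p * z $ i * y $ j)"

text \<open>The last three conjuncts say that the partial derivatives of the form with respect to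
  \<open>x $ p\<close>, \<open>y $ j\<close> and \<open>z $ i\<close> vanish at \<open>(x, y, z)\<close>.\<close>

definition degenerate :: "'a::comm_ring_1 hypermat \<Rightarrow> bool" where
  "degenerate M \<longleftrightarrow>
     (\<exists>x y z. x \<noteq> 0 \<and> y \<noteq> 0 \<and> z \<noteq> 0 \<and>
        trilinear_form M x y z = 0 \<and>
        (\<forall>p. (\<Sum>i\<in>UNIV. \<Sum>j\<in>UNIV. M $ p $ i $ j * z $ i * y $ j) = 0) \<and>
        (\<forall>j. (\<Sum>p\<in>UNIV. \<Sum>i\<in>UNIV. M $ p $ i $ j * x $ p * z $ i) = 0) \<and>
        (\<forall>i. (\<Sum>p\<in>UNIV. \<Sum>j\<in>UNIV. M $ p $ i $ j * x $ p * y $ j) = 0))"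

section \<open>The hyperdeterminant\<close>

text \<open>A polynomial in the 24 entries; the variable \<open>(p, i, j)\<close> stands for \<open>M $ p $ i $ j\<close>.\<close>

type_synonym 'a hypermat_poly = "(2 \<times> 4 \<times> 3, 'a) mpolynomial"

definition hypermat_eval ::
    "('a::zero \<Rightarrow> 'r::comm_ring_1) \<Rightarrow> 'a hypermat_poly \<Rightarrow> 'r hypermat \<Rightarrow> 'r" where
  "hypermat_eval h P M = mpoly_eval h (\<lambda>(p, i, j). M $ p $ i $ j) P"

text \<open>\<open>P\<close> has coefficients in the field \<open>'a\<close> and is irreducible over it. Invariance and vanishing
  are required at all hypermatrices and group elements over the algebraic closure. Over an infinite
  field, points over \<open>'a\<close> itself would do; over a finite field they do not determine a
  polynomial, nor in general its values at the hypermatrices over that field.\<close>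

definition is_hyperdeterminant :: "'a::field hypermat_poly \<Rightarrow> bool" where
  "is_hyperdeterminant P \<longleftrightarrow>
     Factorial_Ring.irreducible P \<and>
     (\<exists>l::int. \<forall>(g :: 'a alg_closure ^ 2 ^ 2) M. invertible g \<longrightarrow>
        hypermat_eval to_ac P (act_2 g M) = det g powi l * hypermat_eval to_ac P M) \<and>
     (\<exists>l::int. \<forall>(A :: 'a alg_closure ^ 3 ^ 3) M. invertible A \<longrightarrow>
        hypermat_eval to_ac P (act_3 A M) = det A powi l * hypermat_eval to_ac P M) \<and>
     (\<exists>l::int. \<forall>(B :: 'a alg_closure ^ 4 ^ 4) M. invertible B \<longrightarrow>
        hypermat_eval to_ac P (act_4 B M) = det B powi l * hypermat_eval to_ac P M) \<and>
     (\<forall>M :: 'a alg_closure hypermat. hypermat_eval to_ac P M = 0 \<longleftrightarrow> degenerate M) \<and>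
     hypermat_eval id P id_hypermat = 1"

section \<open>The expansion\<close>

text \<open>The sum is parenthesised in groups because a flat sum of this length is very slow to
  parse.\<close>

definition hyperdet_expansion :: "'r::comm_ring_1 ^ 3 ^ 4 \<Rightarrow> 'r" where
  "hyperdet_expansion b =
    (let
       b00 = b $ 0 $ 0; b01 = b $ 0 $ 1; b02 = b $ 0 $ 2;
       b10 = b $ 1 $ 0; b11 = b $ 1 $ 1; b12 = b $ 1 $ 2;
       b20 = b $ 2 $ 0; b21 = b $ 2 $ 1; b22 = b $ 2 $ 2;
       b30 = b $ 3 $ 0; b31 = b $ 3 $ 1; b32 = b $ 3 $ 2
     in
      (b32 * b31 * b30 * b22 * b21 * b12 - b32^2 * b30 * b21^2 * b12 - b32 * b31^2 * b22 * b20 * b12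
        + b32^2 * b31 * b21 * b20 * b12)
      + (b31^2 * b30 * b21 * b12^2 - b31^3 * b20 * b12^2 - b32 * b31 * b30 * b22^2 * b11
        + b32^2 * b30 * b22 * b21 * b11)
      + (b32^2 * b31 * b22 * b20 * b11 - b32^3 * b21 * b20 * b11 - b31^2 * b30 * b22 * b12 * b11
        - b32 * b31 * b30 * b21 * b12 * b11)
      + (2 * b32 * b31^2 * b20 * b12 * b11 + b32 * b31 * b30 * b22 * b11^2 - b32^2 * b31 * b20 * b11^2
        + b32 * b31^2 * b22^2 * b10 - 2 * b32^2 * b31 * b22 * b21 * b10)
      + (b32^3 * b21^2 * b10 + b31^3 * b22 * b12 * b10 - b32 * b31^2 * b21 * b12 * b10
        - b32 * b31^2 * b22 * b11 * b10)
      + (b32^2 * b31 * b21 * b11 * b10 + b32 * b30^2 * b22 * b21 * b02 - b32 * b31 * b30 * b22 * b20 * b02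
        - b32^2 * b30 * b21 * b20 * b02)
      + (b32^2 * b31 * b20^2 * b02 + 2 * b31 * b30^2 * b21 * b12 * b02 - 2 * b31^2 * b30 * b20 * b12 * b02
        - b31 * b30^2 * b22 * b11 * b02)
      + (b32 * b30^2 * b21 * b11 * b02 + b31 * b30^2 * b11^2 * b02 + b31^2 * b30 * b22 * b10 * b02
        - 3 * b32 * b31 * b30 * b21 * b10 * b02)
      + (2 * b32 * b31^2 * b20 * b10 * b02 - 2 * b31^2 * b30 * b11 * b10 * b02 + b31^3 * b10^2 * b02
        + b30^3 * b21 * b02^2 - b31 * b30^2 * b20 * b02^2 - b32 * b30^2 * b22^2 * b01)
      + (2 * b32^2 * b30 * b22 * b20 * b01 - b32^3 * b20^2 * b01 - b31 * b30^2 * b22 * b12 * b01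
        - 2 * b32 * b30^2 * b21 * b12 * b01)
      + (3 * b32 * b31 * b30 * b20 * b12 * b01 + b32 * b30^2 * b22 * b11 * b01 - b32^2 * b30 * b20 * b11 * b01
        - b31 * b30^2 * b12 * b11 * b01)
      + (2 * b32^2 * b30 * b21 * b10 * b01 - 2 * b32^2 * b31 * b20 * b10 * b01 + b31^2 * b30 * b12 * b10 * b01
        + b32 * b31 * b30 * b11 * b10 * b01 - b32 * b31^2 * b10^2 * b01 - b30^3 * b22 * b02 * b01)
      + (b32 * b30^2 * b20 * b02 * b01 + b30^3 * b11 * b02 * b01 - b31 * b30^2 * b10 * b02 * b01
        - b30^3 * b12 * b01^2)
      + (b32 * b30^2 * b10 * b01^2 + b32 * b31 * b30 * b22^2 * b00 - b32^2 * b30 * b22 * b21 * b00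
        - b32^2 * b31 * b22 * b20 * b00)
      + (b32^3 * b21 * b20 * b00 + b31^2 * b30 * b22 * b12 * b00 - b32 * b31^2 * b20 * b12 * b00
        - b32^2 * b30 * b21 * b11 * b00)
      + (b32^2 * b31 * b20 * b11 * b00 + b31^2 * b30 * b12 * b11 * b00 - b32 * b31 * b30 * b11^2 * b00
        - b32 * b31^2 * b22 * b10 * b00)
      + (b32^2 * b31 * b21 * b10 * b00 - b31^3 * b12 * b10 * b00 + b32 * b31^2 * b11 * b10 * b00
        + b31 * b30^2 * b22 * b02 * b00 - 2 * b32 * b30^2 * b21 * b02 * b00)
      + (b32 * b31 * b30 * b20 * b02 * b00 - b31 * b30^2 * b11 * b02 * b00 + b31^2 * b30 * b10 * b02 * b00
        + b32 * b30^2 * b22 * b01 * b00 - b32^2 * b30 * b20 * b01 * b00)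
      + (2 * b31 * b30^2 * b12 * b01 * b00 - b32 * b30^2 * b11 * b01 * b00 - b32 * b31 * b30 * b10 * b01 * b00
        - b32 * b31 * b30 * b22 * b00^2)
      + (b32^2 * b30 * b21 * b00^2 - b31^2 * b30 * b12 * b00^2 + b32 * b31 * b30 * b11 * b00^2))"

end

theory Submission
  imports Defs
begin

text \<open>
  The proof exhibits the hyperdeterminant as an explicit polynomial. For \<open>M = (M0, M1)\<close> the four
  maximal minors of the pencil \<open>x M0 + y M1\<close> are binary cubics in \<open>(x, y)\<close>, and \<open>hyperdet M\<close> is the
  determinant of their 4 x 4 coefficient matrix. The minors are the coordinates of the linear form
  that sends a column \<open>v\<close> to the determinant of \<open>x M0 + y M1\<close> bordered by \<open>v\<close>, so the action of
  \<open>B \<in> GL_4\<close> multiplies \<open>hyperdet\<close> by \<open>det B ^ 3\<close> (\<open>hyperdet_act_4\<close>). If the first slice is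
  the identity above a zero row, then the definition expands to the required sum of monomials
  (\<open>hyperdet_slices\<close>).

  Let \<open>D\<close> satisfy the definition of the hyperdeterminant. Comparing the scalars of \<open>GL_3\<close> with
  those of \<open>GL_4\<close> shows that \<open>D\<close> has the weights \<open>4 m\<close> and \<open>3 m\<close> for some integer \<open>m\<close>.
  A hypermatrix \<open>M\<close> in general position can be moved to the normalized one
  \<open>id_hypermat\<close>: an element of \<open>GL_4\<close> makes the first slice the identity above a zero row,
  and if the second slice then consists of a square block \<open>T\<close> above a row \<open>r\<close>, a basis
  \<open>p, T p, T^2 p\<close> with \<open>r p = r T p = 0\<close> brings it to the companion form. This is possible
  as soon as the determinant of the rows \<open>r, r T, r T^2\<close>, which is \<open>- hyperdet\<close>, does not vanish
  (\<open>slices_to_id_hypermat\<close>). Following \<open>D\<close> along these moves gives \<open>D M = hyperdet M powi m\<close> on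
  the open set where \<open>hyperdet M\<close> and the upper 3 x 3 minor of \<open>M0\<close> are nonzero
  (\<open>relative_invariant_eq_power_hyperdet\<close>).

  The algebraic closure is infinite, so an identity that holds on a nonempty open set of its points
  is an identity of polynomials with coefficients in the original field
  (\<open>common_nonzero_point\<close>). A negative \<open>m\<close> or \<open>m = 0\<close> would make \<open>D\<close> a unit, and \<open>m > 1\<close> would
  factor \<open>D\<close>, against irreducibility. Hence \<open>D = hyperdet\<close> as polynomials, and both claims are
  evaluations of this identity, at points of the field and at the indeterminates.
\<close>

section \<open>Homomorphisms of commutative rings\<close>

text \<open>Polynomials are evaluated along the inclusion of a field in its closure, along the identity, along
  \<open>mconst\<close> and along evaluations themselves; one locale serves all of these.\<close>

locale comm_ring_map =
  fixes h :: "'a::comm_ring_1 \<Rightarrow> 'r::comm_ring_1"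
  assumes map_add: "h (a + b) = h a + h b"
    and map_mult: "h (a * b) = h a * h b"
    and map_one: "h 1 = 1"
begin

lemma map_zero: "h 0 = 0"
  using map_add[of 0 0] by simp

lemma map_uminus: "h (- a) = - h a"
  using map_add[of a "- a"] map_zero by (simp add: eq_neg_iff_add_eq_0 add.commute)

lemma map_diff: "h (a - b) = h a - h b"
  using map_add[of a "- b"] map_uminus by simp

lemma map_sum: "h (sum f S) = (\<Sum>x\<in>S. h (f x))"
  by (induction S rule: infinite_finite_induct) (auto simp: map_zero map_add)

lemma map_prod: "h (prod f S) = (\<Prod>x\<in>S. h (f x))"
  by (induction S rule: infinite_finite_induct) (auto simp: map_one map_mult)

lemma map_power: "h (a ^ n) = h a ^ n"
  by (induction n) (auto simp: map_one map_mult)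

lemma map_sign: "h (of_int (sign p)) = of_int (sign p)"
  by (simp add: sign_def map_one map_uminus)

lemma map_det: "h (det A) = det (\<chi> i j. h (A $ i $ j))"
  by (simp add: det_def map_sum map_mult map_prod map_sign)

end

section \<open>Evaluation of multivariate polynomials\<close>

definition monomial_value :: "('v \<Rightarrow> 'r::comm_ring_1) \<Rightarrow> ('v \<Rightarrow>\<^sub>0 nat) \<Rightarrow> 'r" where
  "monomial_value x m = (\<Prod>v\<in>Poly_Mapping.keys m. x v ^ Poly_Mapping.lookup m v)"

lemma monomial_value_UNIV:
  fixes x :: "'v::finite \<Rightarrow> 'r::comm_ring_1"
  shows "monomial_value x m = (\<Prod>v\<in>UNIV. x v ^ Poly_Mapping.lookup m v)"
  unfolding monomial_value_def
  by (rule prod.mono_neutral_left) (auto simp: in_keys_iff)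

lemma monomial_value_add:
  fixes x :: "'v::finite \<Rightarrow> 'r::comm_ring_1"
  shows "monomial_value x (m + n) = monomial_value x m * monomial_value x n"
  by (simp add: monomial_value_UNIV lookup_add power_add prod.distrib)

lemma mpoly_eq_sum_singles:
  fixes P :: "('v, 'a::comm_ring_1) mpolynomial"
  shows "P = (\<Sum>m\<in>Poly_Mapping.keys P. Poly_Mapping.single m (Poly_Mapping.lookup P m))"
  by (rule poly_mapping_eqI) (simp add: lookup_sum lookup_single when_def in_keys_iff)

context comm_ring_map
begin

lemma mpoly_eval_superset:
  assumes "finite S" "Poly_Mapping.keys P \<subseteq> S"
  shows "mpoly_eval h x P = (\<Sum>m\<in>S. h (Poly_Mapping.lookup P m) * monomial_value x m)"
  unfolding mpoly_eval_def monomial_value_def[symmetric]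
  by (rule sum.mono_neutral_left) (use assms in \<open>auto simp: in_keys_iff map_zero\<close>)

lemma mpoly_eval_zero: "mpoly_eval h x 0 = 0"
  by (simp add: mpoly_eval_def)

lemma mpoly_eval_add: "mpoly_eval h x (P + Q) = mpoly_eval h x P + mpoly_eval h x Q"
proof -
  define S where "S = Poly_Mapping.keys P \<union> Poly_Mapping.keys Q"
  have S: "finite S" "Poly_Mapping.keys P \<subseteq> S" "Poly_Mapping.keys Q \<subseteq> S"
      "Poly_Mapping.keys (P + Q) \<subseteq> S"
    using Poly_Mapping.keys_add[of P Q] by (auto simp: S_def)
  show ?thesis
    by (simp add: mpoly_eval_superset[OF S(1,2)] mpoly_eval_superset[OF S(1,3)]
        mpoly_eval_superset[OF S(1,4)] lookup_add map_add sum.distrib distrib_right)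
qed

lemma mpoly_eval_single: "mpoly_eval h x (Poly_Mapping.single m c) = h c * monomial_value x m"
  by (subst mpoly_eval_superset[of "{m}"]) auto

lemma mpoly_eval_sum: "mpoly_eval h x (sum P S) = (\<Sum>i\<in>S. mpoly_eval h x (P i))"
  by (induction S rule: infinite_finite_induct) (auto simp: mpoly_eval_zero mpoly_eval_add)

lemma mpoly_eval_mult:
  fixes x :: "'v::finite \<Rightarrow> 'r"
  shows "mpoly_eval h x (P * Q) = mpoly_eval h x P * mpoly_eval h x Q"
proof -
  have "P * Q = (\<Sum>m\<in>Poly_Mapping.keys P. \<Sum>n\<in>Poly_Mapping.keys Q.
      Poly_Mapping.single (m + n) (Poly_Mapping.lookup P m * Poly_Mapping.lookup Q n))"
    using arg_cong2[OF mpoly_eq_sum_singles[of P] mpoly_eq_sum_singles[of Q], of "(*)"]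
    by (simp only: sum_product mult_single)
  then have "mpoly_eval h x (P * Q) = (\<Sum>m\<in>Poly_Mapping.keys P. \<Sum>n\<in>Poly_Mapping.keys Q.
      (h (Poly_Mapping.lookup P m) * monomial_value x m) *
      (h (Poly_Mapping.lookup Q n) * monomial_value x n))"
    by (simp add: mpoly_eval_sum mpoly_eval_single map_mult monomial_value_add mult_ac)
  also have "\<dots> = mpoly_eval h x P * mpoly_eval h x Q"
    by (simp add: mpoly_eval_def sum_product flip: monomial_value_def)
  finally show ?thesis .
qed

lemma comm_ring_map_mpoly_eval:
  fixes x :: "'v::finite \<Rightarrow> 'r"
  shows "comm_ring_map (mpoly_eval h x)"
proof
  show "mpoly_eval h x 1 = 1"
    using mpoly_eval_single[of x 0 1] by (simp add: map_one monomial_value_def)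
qed (simp_all add: mpoly_eval_add mpoly_eval_mult)

lemma mpoly_eval_mvar: "mpoly_eval h x (mvar v) = x v"
  by (simp add: mvar_def mpoly_eval_single map_one monomial_value_def)

end

lemma comm_ring_map_id: "comm_ring_map id"
  by unfold_locales auto

lemma comm_ring_map_to_ac: "comm_ring_map (to_ac :: 'a::field \<Rightarrow> _)"
  by unfold_locales auto

lemma comm_ring_map_mconst:
  "comm_ring_map (mconst :: 'a::comm_ring_1 \<Rightarrow> ('v, 'a) mpolynomial)"
  by unfold_locales (auto simp: mconst_def single_add mult_single)

section \<open>Nonvanishing of polynomials over infinite fields\<close>

text \<open>If the field were finite, then one plus the product of all \<open>x - a\<close> would have no root.\<close>

lemma infinite_UNIV_alg_closed_field: "infinite (UNIV :: 'k::alg_closed_field set)"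
proof
  assume fin: "finite (UNIV :: 'k set)"
  define p :: "'k poly" where "p = (\<Prod>a\<in>UNIV. [:- a, 1:])"
  have "Polynomial.degree p = card (UNIV :: 'k set)"
    unfolding p_def by (subst degree_prod_eq_sum_degree) auto
  moreover have "card (UNIV :: 'k set) > 0"
    using fin by (simp add: card_gt_0_iff)
  ultimately have "Polynomial.degree (p + 1) > 0"
    by (subst degree_add_eq_left) auto
  then obtain x where "poly (p + 1) x = 0"
    using alg_closed_imp_poly_has_root by blast
  moreover have "poly p x = 0"
    unfolding p_def poly_prod using fin by (intro prod_zero bexI[of _ x]) simp_all
  ultimately show False by simp
qed

text \<open>Positional notation: if the weights are the powers of \<open>N\<close>, then the weighted sum of digits below
  \<open>N\<close> determines the digits. The induction adds a new lowest digit.\<close>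

lemma obtain_separating_weights:
  fixes N :: nat
  assumes "finite V"
  obtains w :: "'v \<Rightarrow> nat"
  where "\<And>m n. \<lbrakk>\<forall>v\<in>V. m v < N; \<forall>v\<in>V. n v < N; (\<Sum>v\<in>V. m v * w v) = (\<Sum>v\<in>V. n v * w v)\<rbrakk>
    \<Longrightarrow> \<forall>v\<in>V. m v = n v"
proof -
  have "\<exists>w :: 'v \<Rightarrow> nat. \<forall>m n. (\<forall>v\<in>V. m v < N) \<longrightarrow> (\<forall>v\<in>V. n v < N) \<longrightarrow>
      (\<Sum>v\<in>V. m v * w v) = (\<Sum>v\<in>V. n v * w v) \<longrightarrow> (\<forall>v\<in>V. m v = n v)"
    using assms
  proof (induction V)
    case empty
    show ?case by simp
  next
    case (insert u V)
    obtain w :: "'v \<Rightarrow> nat" where w: "\<And>m n. \<lbrakk>\<forall>v\<in>V. m v < N; \<forall>v\<in>V. n v < N;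
      (\<Sum>v\<in>V. m v * w v) = (\<Sum>v\<in>V. n v * w v)\<rbrakk> \<Longrightarrow> \<forall>v\<in>V. m v = n v"
      using insert.IH by blast
    define w' where "w' = (\<lambda>v. if v = u then 1 else N * w v)"
    have sum_w': "(\<Sum>v\<in>insert u V. m v * w' v) = m u + N * (\<Sum>v\<in>V. m v * w v)" for m
    proof -
      have "(\<Sum>v\<in>V. m v * w' v) = (\<Sum>v\<in>V. N * (m v * w v))"
        using insert.hyps by (intro sum.cong) (auto simp: w'_def)
      then show ?thesis
        using insert.hyps by (simp add: w'_def sum_distrib_left)
    qed
    have "\<forall>v\<in>insert u V. m v = n v"
      if m: "\<forall>v\<in>insert u V. m v < N" and n: "\<forall>v\<in>insert u V. n v < N"
        and eq: "(\<Sum>v\<in>insert u V. m v * w' v) = (\<Sum>v\<in>insert u V. n v * w' v)" for m n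
    proof -
      have eq': "m u + N * (\<Sum>v\<in>V. m v * w v) = n u + N * (\<Sum>v\<in>V. n v * w v)"
        using eq by (simp only: sum_w')
      have lt: "m u < N" "n u < N" using m n by auto
      have "m u = n u" using arg_cong[OF eq', of "\<lambda>k. k mod N"] lt by simp
      moreover have "(\<Sum>v\<in>V. m v * w v) = (\<Sum>v\<in>V. n v * w v)"
        using eq' \<open>m u = n u\<close> lt by simp
      ultimately show ?thesis using w m n by simp
    qed
    then show ?case by blast
  qed
  then show ?thesis using that by blast
qed

text \<open>Kronecker substitution: replacing each variable \<open>v\<close> by \<open>t ^ w v\<close> with separating weights \<open>w\<close>
  sends the monomials of \<open>P\<close> and \<open>Q\<close> to distinct powers of \<open>t\<close>, so both become nonzero
  polynomials in \<open>t\<close>, whose product has only finitely many roots. This contains both the identity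
  principle and the density of nonempty Zariski open sets.\<close>

lemma common_nonzero_point:
  fixes h :: "'a::comm_ring_1 \<Rightarrow> 'k::field" and P Q :: "('v::finite, 'a) mpolynomial"
  assumes "comm_ring_map h" "inj h" "infinite (UNIV :: 'k set)" "P \<noteq> 0" "Q \<noteq> 0"
  obtains x where "mpoly_eval h x P \<noteq> 0" "mpoly_eval h x Q \<noteq> 0"
proof -
  interpret comm_ring_map h by fact
  define S where "S = Poly_Mapping.keys P \<union> Poly_Mapping.keys Q"
  have fin: "finite S" by (simp add: S_def)
  define N where "N = Suc (\<Sum>m\<in>S. \<Sum>v\<in>UNIV. Poly_Mapping.lookup m v)"
  have less_N: "Poly_Mapping.lookup m v < N" if "m \<in> S" for m v
  proof -
    have "Poly_Mapping.lookup m v \<le> (\<Sum>v\<in>UNIV. Poly_Mapping.lookup m v)"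
      by (rule member_le_sum) auto
    also have "\<dots> \<le> (\<Sum>m\<in>S. \<Sum>v\<in>UNIV. Poly_Mapping.lookup m v)"
      using that fin by (intro member_le_sum) auto
    finally show ?thesis by (simp add: N_def)
  qed
  obtain w :: "'v \<Rightarrow> nat" where w: "\<And>m n. \<lbrakk>\<forall>v\<in>UNIV. m v < N; \<forall>v\<in>UNIV. n v < N;
      (\<Sum>v\<in>UNIV. m v * w v) = (\<Sum>v\<in>UNIV. n v * w v)\<rbrakk> \<Longrightarrow> \<forall>v\<in>UNIV. m v = n v"
    by (rule obtain_separating_weights[of "UNIV :: 'v set" N]) auto
  define e where "e m = (\<Sum>v\<in>UNIV. Poly_Mapping.lookup m v * w v)" for m
  have inj_e: "m = n" if "m \<in> S" "n \<in> S" "e m = e n" for m n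
    using w[of "Poly_Mapping.lookup m" "Poly_Mapping.lookup n"] that less_N
    by (auto simp: e_def intro: poly_mapping_eqI)
  define u where "u R = (\<Sum>m\<in>Poly_Mapping.keys R. Polynomial.monom (h (Poly_Mapping.lookup R m)) (e m))"
    for R :: "('v, 'a) mpolynomial"
  have poly_u: "poly (u R) t = mpoly_eval h (\<lambda>v. t ^ w v) R" for R t
  proof -
    have "monomial_value (\<lambda>v. t ^ w v) m = t ^ e m" for m
      by (simp add: monomial_value_UNIV e_def power_sum mult.commute flip: power_mult)
    then show ?thesis
      by (simp add: u_def poly_sum poly_monom mpoly_eval_def flip: monomial_value_def)
  qed
  have u_nonzero: "u R \<noteq> 0" if "R \<noteq> 0" "Poly_Mapping.keys R \<subseteq> S" for R
  proof -
    obtain n where n: "n \<in> Poly_Mapping.keys R"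
      using \<open>R \<noteq> 0\<close> by (metis keys_eq_empty all_not_in_conv)
    have "Polynomial.coeff (u R) (e n) =
        (\<Sum>m\<in>Poly_Mapping.keys R. if m = n then h (Poly_Mapping.lookup R m) else 0)"
      unfolding u_def coeff_sum coeff_monom
      by (intro sum.cong refl if_cong iffI) (use inj_e that(2) n in auto)
    also have "\<dots> = h (Poly_Mapping.lookup R n)" using n by simp
    also have "\<dots> \<noteq> 0"
      using n \<open>inj h\<close> map_zero by (metis in_keys_iff injD)
    finally show ?thesis by auto
  qed
  have "u P * u Q \<noteq> 0" using u_nonzero assms by (simp add: S_def)
  then have "finite {t. poly (u P * u Q) t = 0}" by (rule poly_roots_finite)
  then obtain t where "poly (u P * u Q) t \<noteq> 0"
    using ex_new_if_finite[OF assms(3)] by blast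
  then show ?thesis using that[of "\<lambda>v. t ^ w v"] by (simp add: poly_u)
qed

section \<open>Determinants with indices from 0\<close>

text \<open>The library names the elements of \<open>3\<close> and \<open>4\<close> by \<open>1, 2, 3\<close> and \<open>1, 2, 3, 4\<close>; the last one is the
  residue \<open>0\<close>, which comes first here.\<close>

lemma three_eq_zero: "(3::3) = 0" and four_eq_zero: "(4::4) = 0" and two_eq_zero: "(2::2) = 0"
  by simp_all

lemma UNIV_3_from_0: "(UNIV :: 3 set) = {0, 1, 2}"
  unfolding UNIV_3 three_eq_zero by blast

lemma UNIV_4_from_0: "(UNIV :: 4 set) = {0, 1, 2, 3}"
  unfolding UNIV_4 four_eq_zero by blast

lemma sum_3_from_0: "(\<Sum>j\<in>UNIV. f j) = f 0 + f 1 + f (2::3)"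
  unfolding UNIV_3_from_0 by (simp add: add.assoc)

lemma sum_4_from_0: "(\<Sum>i\<in>UNIV. f i) = f 0 + f 1 + f 2 + f (3::4)"
  unfolding UNIV_4_from_0 by (simp add: add.assoc)

lemma forall_3_from_0: "(\<forall>j. Q j) \<longleftrightarrow> Q 0 \<and> Q 1 \<and> Q (2::3)"
  using forall_3[of Q] unfolding three_eq_zero by blast

lemma forall_4_from_0: "(\<forall>i. Q i) \<longleftrightarrow> Q 0 \<and> Q 1 \<and> Q 2 \<and> Q (3::4)"
  using forall_4[of Q] unfolding four_eq_zero by blast

lemma forall_2_from_0: "(\<forall>p. Q p) \<longleftrightarrow> Q 0 \<and> Q (1::2)"
  using forall_2[of Q] unfolding two_eq_zero by blast

lemma det_3_from_0:
  fixes A :: "'a::comm_ring_1^3^3"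
  shows "det A =
     A$0$0 * A$1$1 * A$2$2 + A$0$1 * A$1$2 * A$2$0 + A$0$2 * A$1$0 * A$2$1
   - A$0$0 * A$1$2 * A$2$1 - A$0$1 * A$1$0 * A$2$2 - A$0$2 * A$1$1 * A$2$0"
  unfolding det_3 three_eq_zero by (simp only: mult_ac add_ac diff_conv_add_uminus)

lemma det_4_from_0:
  fixes A :: "'a::comm_ring_1^4^4"
  shows "det A =
      A$0$0 * (A$1$1 * A$2$2 * A$3$3 + A$1$2 * A$2$3 * A$3$1 + A$1$3 * A$2$1 * A$3$2
             - A$1$1 * A$2$3 * A$3$2 - A$1$2 * A$2$1 * A$3$3 - A$1$3 * A$2$2 * A$3$1)
    - A$0$1 * (A$1$0 * A$2$2 * A$3$3 + A$1$2 * A$2$3 * A$3$0 + A$1$3 * A$2$0 * A$3$2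
             - A$1$0 * A$2$3 * A$3$2 - A$1$2 * A$2$0 * A$3$3 - A$1$3 * A$2$2 * A$3$0)
    + A$0$2 * (A$1$0 * A$2$1 * A$3$3 + A$1$1 * A$2$3 * A$3$0 + A$1$3 * A$2$0 * A$3$1
             - A$1$0 * A$2$3 * A$3$1 - A$1$1 * A$2$0 * A$3$3 - A$1$3 * A$2$1 * A$3$0)
    - A$0$3 * (A$1$0 * A$2$1 * A$3$2 + A$1$1 * A$2$2 * A$3$0 + A$1$2 * A$2$0 * A$3$1
             - A$1$0 * A$2$2 * A$3$1 - A$1$1 * A$2$0 * A$3$2 - A$1$2 * A$2$1 * A$3$0)"
proof -
  have f0: "finite {1, 2, 3::4}" "0 \<notin> {1, 2, 3::4}" and f1: "finite {2, 3::4}" "1 \<notin> {2, 3::4}"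
    and f2: "finite {3::4}" "2 \<notin> {3::4}"
    by auto
  show ?thesis
    unfolding det_def UNIV_4_from_0
    unfolding sum_over_permutations_insert[OF f0]
    unfolding sum_over_permutations_insert[OF f1]
    unfolding sum_over_permutations_insert[OF f2]
    unfolding permutes_sing
    by (simp add: sign_swap_id permutation_swap_id permutation_compose sign_compose sign_id
        swap_id_eq) (simp add: algebra_simps)
qed

section \<open>The determinant of the coefficients of the maximal minors\<close>

definition cols4 :: "'r::comm_ring_1 ^ 4 \<Rightarrow> 'r ^ 4 \<Rightarrow> 'r ^ 4 \<Rightarrow> 'r ^ 4 \<Rightarrow> 'r ^ 4 ^ 4" where
  "cols4 u0 u1 u2 u3 =
    (\<chi> i j. if j = 0 then u0 $ i else if j = 1 then u1 $ i else if j = 2 then u2 $ i else u3 $ i)"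

lemma cols4_nth [simp]:
  "cols4 u0 u1 u2 u3 $ i $ 0 = u0 $ i" "cols4 u0 u1 u2 u3 $ i $ 1 = u1 $ i"
  "cols4 u0 u1 u2 u3 $ i $ 2 = u2 $ i" "cols4 u0 u1 u2 u3 $ i $ 3 = u3 $ i"
  by (simp_all add: cols4_def)

lemma matrix_mult_cols4: "B ** cols4 u0 u1 u2 u3 = cols4 (B *v u0) (B *v u1) (B *v u2) (B *v u3)"
  by (simp add: vec_eq_iff cols4_def matrix_matrix_mult_def matrix_vector_mult_def)

lemma det_cols4_last:
  "det (cols4 u0 u1 u2 v) = (\<Sum>i\<in>UNIV. v $ i * det (cols4 u0 u1 u2 (axis i 1)))"
  by (simp add: sum_4_from_0 det_4_from_0 axis_def algebra_simps)

text \<open>The coefficient of \<open>x ^ (3 - k) * y ^ k\<close> in the determinant of the matrix that consists of the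
  three columns of \<open>x M0 + y M1\<close> and the column \<open>v\<close>. Taking \<open>v\<close> from the standard basis gives the
  signed maximal minors of the pencil.\<close>

definition minor_coeff :: "'r::comm_ring_1 hypermat \<Rightarrow> 4 \<Rightarrow> 'r ^ 4 \<Rightarrow> 'r" where
  "minor_coeff M k v =
    (let D = (\<lambda>p q s. det (cols4 (column 0 (M $ p)) (column 1 (M $ q)) (column 2 (M $ s)) v))
     in if k = 0 then D 0 0 0
        else if k = 1 then D 1 0 0 + D 0 1 0 + D 0 0 1
        else if k = 2 then D 1 1 0 + D 1 0 1 + D 0 1 1
        else D 1 1 1)"

definition minor_matrix :: "'r::comm_ring_1 hypermat \<Rightarrow> 'r ^ 4 ^ 4" where
  "minor_matrix M = (\<chi> k i. minor_coeff M k (axis i 1))"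

definition hyperdet :: "'r::comm_ring_1 hypermat \<Rightarrow> 'r" where
  "hyperdet M = det (minor_matrix M)"

lemma minor_coeff_linear: "minor_coeff M k v = (\<Sum>i\<in>UNIV. minor_matrix M $ k $ i * v $ i)"
  unfolding minor_matrix_def minor_coeff_def Let_def
  by (subst (1 2 3 4 5 6 7 8) det_cols4_last)
    (simp add: sum.distrib sum_distrib_left sum_distrib_right algebra_simps)

lemma column_act_4: "column j (act_4 B M $ p) = B *v column j (M $ p)"
  by (simp add: vec_eq_iff act_4_def column_def matrix_matrix_mult_def matrix_vector_mult_def)

lemma minor_coeff_act_4: "minor_coeff (act_4 B M) k (B *v v) = det B * minor_coeff M k v"
  by (simp add: minor_coeff_def column_act_4 det_mul Let_def distrib_left flip: matrix_mult_cols4)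

text \<open>Since the minors form a linear form in \<open>v\<close>, moving \<open>B\<close> from the pencil to \<open>v\<close> turns
  the invariance of the bordered determinant into a matrix identity.\<close>

lemma minor_matrix_act_4: "minor_matrix (act_4 B M) ** B = (\<chi> k. det B *s minor_matrix M $ k)"
proof -
  have "(minor_matrix (act_4 B M) ** B) $ k $ j = det B * minor_matrix M $ k $ j" for k j
  proof -
    have "(minor_matrix (act_4 B M) ** B) $ k $ j = minor_coeff (act_4 B M) k (column j B)"
      by (simp add: minor_coeff_linear matrix_matrix_mult_def column_def)
    also have "column j B = B *v axis j 1"
      by (simp add: vec_eq_iff column_def matrix_vector_mult_def axis_def if_distrib cong: if_cong)
    also have "minor_coeff (act_4 B M) k (B *v axis j 1) = det B * minor_matrix M $ k $ j"
      by (simp only: minor_coeff_act_4) (simp add: minor_matrix_def)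
    finally show ?thesis .
  qed
  then show ?thesis by (simp add: vec_eq_iff)
qed

lemma hyperdet_act_4:
  fixes M :: "'k::field hypermat"
  assumes "det B \<noteq> 0"
  shows "hyperdet (act_4 B M) = det B ^ 3 * hyperdet M"
proof -
  have "hyperdet (act_4 B M) * det B = det (\<chi> k. det B *s minor_matrix M $ k)"
    by (simp add: hyperdet_def flip: minor_matrix_act_4 det_mul)
  also have "\<dots> = det B ^ 4 * hyperdet M"
    by (simp add: det_rows_mul hyperdet_def)
  finally have "hyperdet (act_4 B M) * det B = (det B ^ 3 * hyperdet M) * det B"
    by (simp add: eval_nat_numeral mult_ac)
  then show ?thesis using assms by simp
qed

lemma slice_nth [simp]:
  "hypermat_of_slices M0 M1 $ 0 = M0" "hypermat_of_slices M0 M1 $ 1 = M1"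
  by (simp_all add: hypermat_of_slices_def)

lemma id_over_zero_nth:
  "id_over_zero $ i $ j = (if (i, j) \<in> {(0, 0), (1, 1), (2, 2)} then 1 else 0)"
  by (simp add: id_over_zero_def)

text \<open>The coefficients of \<open>x ^ 3\<close>, \<open>x ^ 2 * y\<close> and \<open>x * y ^ 2\<close> are written out, since their matrix is
  sparse; expanding the 4 x 4 determinant all at once would be much larger.\<close>

lemma minor_coeff_slices:
  "minor_coeff (hypermat_of_slices id_over_zero b) 0 v = v $ 3"
  "minor_coeff (hypermat_of_slices id_over_zero b) 1 v =
    (b$0$0 + b$1$1 + b$2$2) * v$3 - b$3$0 * v$0 - b$3$1 * v$1 - b$3$2 * v$2"
  "minor_coeff (hypermat_of_slices id_over_zero b) 2 v =
    (b$0$0 * b$1$1 - b$0$1 * b$1$0 + b$0$0 * b$2$2 - b$0$2 * b$2$0 + b$1$1 * b$2$2 - b$1$2 * b$2$1) * v$3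
    + (b$1$0 * b$3$1 - b$1$1 * b$3$0 + b$2$0 * b$3$2 - b$2$2 * b$3$0) * v$0
    + (b$0$1 * b$3$0 - b$0$0 * b$3$1 + b$2$1 * b$3$2 - b$2$2 * b$3$1) * v$1
    + (b$0$2 * b$3$0 - b$0$0 * b$3$2 + b$1$2 * b$3$1 - b$1$1 * b$3$2) * v$2"
  by (simp_all add: minor_coeff_def det_4_from_0 column_def id_over_zero_nth algebra_simps)

lemma hyperdet_slices: "hyperdet (hypermat_of_slices id_over_zero b) = hyperdet_expansion b"
proof -
  have m3: "minor_coeff (hypermat_of_slices id_over_zero b) 3 v =
    det (cols4 (column 0 b) (column 1 b) (column 2 b) v)" for v
    by (simp add: minor_coeff_def)
  \<comment> \<open>The numerals are split so that equal monomials on the two sides match one to one.\<close>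
  have two: "(2::'a) = 1 + 1" and three: "(3::'a) = 1 + 1 + 1" by simp_all
  show ?thesis
    unfolding hyperdet_def det_4_from_0
    by (simp add: minor_matrix_def minor_coeff_slices m3 det_4_from_0 column_def axis_def
        hyperdet_expansion_def Let_def)
      (simp only: two three power2_eq_square power3_eq_cube algebra_simps mult_1_left mult_1_right, simp)
qed

section \<open>Moving a hypermatrix to the normalized one\<close>

definition top_square :: "'r::comm_ring_1 ^ 3 ^ 4 \<Rightarrow> 'r ^ 3 ^ 3" where
  "top_square b = (\<chi> i. if i = 0 then b $ 0 else if i = 1 then b $ 1 else b $ 2)"

text \<open>The block matrix with \<open>P\<close> in the upper left corner, \<open>u\<close> as the rest of the last column, \<open>q\<close> as
  the rest of the last row, and \<open>c\<close> in the corner.\<close>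

definition bordered :: "'r::comm_ring_1 ^ 3 ^ 3 \<Rightarrow> 'r ^ 3 \<Rightarrow> 'r ^ 3 \<Rightarrow> 'r \<Rightarrow> 'r ^ 4 ^ 4" where
  "bordered P u q c =
    (let ix = (\<lambda>i :: 4. if i = 0 then 0 else if i = 1 then 1 else (2 :: 3)) in
     \<chi> i j. if i = 3 then (if j = 3 then c else q $ ix j)
            else (if j = 3 then u $ ix i else P $ ix i $ ix j))"

lemma top_square_nth [simp]:
  "top_square b $ 0 = b $ 0" "top_square b $ 1 = b $ 1" "top_square b $ 2 = b $ 2"
  by (simp_all add: top_square_def)

lemma bordered_nth [simp]:
  "bordered P u q c $ 0 $ 0 = P $ 0 $ 0" "bordered P u q c $ 0 $ 1 = P $ 0 $ 1"
  "bordered P u q c $ 0 $ 2 = P $ 0 $ 2" "bordered P u q c $ 0 $ 3 = u $ 0"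
  "bordered P u q c $ 1 $ 0 = P $ 1 $ 0" "bordered P u q c $ 1 $ 1 = P $ 1 $ 1"
  "bordered P u q c $ 1 $ 2 = P $ 1 $ 2" "bordered P u q c $ 1 $ 3 = u $ 1"
  "bordered P u q c $ 2 $ 0 = P $ 2 $ 0" "bordered P u q c $ 2 $ 1 = P $ 2 $ 1"
  "bordered P u q c $ 2 $ 2 = P $ 2 $ 2" "bordered P u q c $ 2 $ 3 = u $ 2"
  "bordered P u q c $ 3 $ 0 = q $ 0" "bordered P u q c $ 3 $ 1 = q $ 1"
  "bordered P u q c $ 3 $ 2 = q $ 2" "bordered P u q c $ 3 $ 3 = c"
  by (simp_all add: bordered_def Let_def)

lemma det_bordered_lower: "det (bordered P 0 q c) = c * det P"
  by (simp add: det_4_from_0 det_3_from_0 algebra_simps)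

lemma det_bordered_upper: "det (bordered P u 0 c) = c * det P"
  by (simp add: det_4_from_0 det_3_from_0 algebra_simps)

lemma zero_over_id_nth:
  "zero_over_id $ i $ j = (if (i, j) \<in> {(1, 0), (2, 1), (3, 2)} then 1 else 0)"
  by (simp add: zero_over_id_def)

definition dot3 :: "'r::comm_ring_1 ^ 3 \<Rightarrow> 'r ^ 3 \<Rightarrow> 'r" where
  "dot3 u v = u $ 0 * v $ 0 + u $ 1 * v $ 1 + u $ 2 * v $ 2"

definition row_times :: "'r::comm_ring_1 ^ 3 \<Rightarrow> 'r ^ 3 ^ 3 \<Rightarrow> 'r ^ 3" where
  "row_times u T = (\<chi> j. dot3 u (column j T))"

lemma dot3_matrix_vector: "dot3 u (T *v v) = dot3 (row_times u T) v"
  by (simp add: dot3_def row_times_def matrix_vector_mult_def sum_3_from_0 column_def algebra_simps)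

definition cross :: "'r::comm_ring_1 ^ 3 \<Rightarrow> 'r ^ 3 \<Rightarrow> 'r ^ 3" where
  "cross u v = (\<chi> j. if j = 0 then u $ 1 * v $ 2 - u $ 2 * v $ 1
                     else if j = 1 then u $ 2 * v $ 0 - u $ 0 * v $ 2
                     else u $ 0 * v $ 1 - u $ 1 * v $ 0)"

lemma cross_nth [simp]:
  "cross u v $ 0 = u $ 1 * v $ 2 - u $ 2 * v $ 1"
  "cross u v $ 1 = u $ 2 * v $ 0 - u $ 0 * v $ 2"
  "cross u v $ 2 = u $ 0 * v $ 1 - u $ 1 * v $ 0"
  by (simp_all add: cross_def)

lemma dot3_cross: "dot3 u (cross u v) = 0" "dot3 v (cross u v) = 0"
  by (simp_all add: dot3_def algebra_simps)

definition mat3_of_rows :: "'r::comm_ring_1 ^ 3 \<Rightarrow> 'r ^ 3 \<Rightarrow> 'r ^ 3 \<Rightarrow> 'r ^ 3 ^ 3" where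
  "mat3_of_rows u v w = (\<chi> i. if i = 0 then u else if i = 1 then v else w)"

lemma mat3_of_rows_nth [simp]:
  "mat3_of_rows u v w $ 0 = u" "mat3_of_rows u v w $ 1 = v" "mat3_of_rows u v w $ 2 = w"
  by (simp_all add: mat3_of_rows_def)

lemma det_mat3_of_rows: "det (mat3_of_rows u v w) = dot3 w (cross u v)"
  by (simp add: det_3_from_0 dot3_def algebra_simps)

text \<open>The determinant of the rows \<open>r, r T, r T^2\<close>, where \<open>T\<close> is the upper square block of \<open>b\<close> and \<open>r\<close>
  its last row: the observability determinant of the pair \<open>(T, r)\<close>.\<close>

definition krylov_det :: "'r::comm_ring_1 ^ 3 ^ 4 \<Rightarrow> 'r" where
  "krylov_det b = (let T = top_square b; r = b $ 3; s = row_times r T; t = row_times s T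
     in det (mat3_of_rows r s t))"

text \<open>A direct comparison of monomials. Over a field this form shows what it means that the expansion
  does not vanish: \<open>r\<close> is a cyclic row vector of \<open>T\<close>.\<close>

lemma hyperdet_expansion_eq_krylov: "hyperdet_expansion b = - krylov_det (b :: 'a::comm_ring_1 ^ 3 ^ 4)"
proof -
  \<comment> \<open>The numerals are split so that equal monomials on the two sides match one to one.\<close>
  have two: "(2::'a) = 1 + 1" and three: "(3::'a) = 1 + 1 + 1" by simp_all
  show ?thesis
    by (simp add: krylov_det_def Let_def hyperdet_expansion_def det_mat3_of_rows dot3_def
        row_times_def column_def)
      (simp only: two three power2_eq_square power3_eq_cube algebra_simps mult_1_left mult_1_right, simp)
qed

text \<open>The second slice acts on the basis \<open>p0, p1 = T p0, p2 = T p1\<close> as a shift, up to the image of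
  \<open>p2\<close>, which the last column of \<open>B\<close> absorbs. The cross product \<open>p0\<close> of \<open>r\<close> and \<open>r T\<close> is the
  vector, unique up to a scalar, on which \<open>r\<close> and \<open>r T\<close> vanish; without division this leaves the
  scalar \<open>krylov_det b\<close> in the corner of \<open>B\<close>.\<close>

lemma slices_to_id_hypermat:
  fixes b :: "'k::field ^ 3 ^ 4"
  assumes "krylov_det b \<noteq> 0"
  obtains P B where
    "act_3 (transpose P) (hypermat_of_slices id_over_zero b) = act_4 B id_hypermat"
    "det P = - (krylov_det b ^ 2)" "det B = krylov_det b * det P"
proof -
  define T r where "T = top_square b" and "r = b $ 3"
  define s where "s = row_times r T"
  define t where "t = row_times s T"
  define k where "k = krylov_det b"
  define p0 where "p0 = cross r s"
  define p1 where "p1 = T *v p0"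
  define p2 where "p2 = T *v p1"
  define P where "P = transpose (mat3_of_rows p0 p1 p2)"
  define B where "B = bordered P (T *v p2) 0 k"
  have k: "k = det (mat3_of_rows r s t)"
    by (simp add: k_def krylov_det_def T_def r_def s_def t_def Let_def)
  have t0: "dot3 t p0 = k"
    by (simp add: k det_mat3_of_rows p0_def)
  have r0: "dot3 r p0 = 0" and s0: "dot3 s p0 = 0"
    by (simp_all add: p0_def dot3_cross)
  have r1: "dot3 r p1 = 0" and s1: "dot3 s p1 = k" and r2: "dot3 r p2 = k"
    by (simp_all add: p1_def p2_def dot3_matrix_vector s0 t0 flip: s_def t_def)
  have colP: "column 0 P = p0" "column 1 P = p1" "column 2 P = p2"
    by (simp_all add: P_def column_def transpose_def vec_eq_iff)
  have entry: "(A ** P) $ i $ j = dot3 (A $ i) (column j P)" for A :: "'k ^ 3 ^ 3" and i j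
    by (simp add: matrix_matrix_mult_def sum_3_from_0 dot3_def column_def)
  \<comment> \<open>The product is a Hankel matrix with zeros before the antidiagonal and \<open>k\<close> on it.\<close>
  have "k * det P = det (mat3_of_rows r s t ** P)"
    by (simp add: k det_mul)
  also have "\<dots> = - (k ^ 3)"
    by (simp add: det_3_from_0 entry colP r0 s0 t0 r1 s1 r2 power3_eq_cube)
  finally have "k * det P = k * (- (k ^ 2))"
    by (simp add: power2_eq_square power3_eq_cube)
  then have detP: "det P = - (k ^ 2)"
    using assms unfolding mult_cancel_left by (simp add: k_def)
  have bP: "(b ** P) $ 3 $ j = dot3 r (column j P)" for j
    by (simp add: matrix_matrix_mult_def sum_3_from_0 dot3_def column_def r_def)
  have bP': "(b ** P) $ 0 $ j = (T *v column j P) $ 0" "(b ** P) $ 1 $ j = (T *v column j P) $ 1"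
    "(b ** P) $ 2 $ j = (T *v column j P) $ 2" for j
    by (simp_all add: matrix_matrix_mult_def matrix_vector_mult_def column_def T_def)
  have P_nth: "P $ i $ 0 = p0 $ i" "P $ i $ 1 = p1 $ i" "P $ i $ 2 = p2 $ i" for i
    by (simp_all add: P_def transpose_def)
  have "id_over_zero ** P = B ** id_over_zero"
    by (simp add: vec_eq_iff forall_4_from_0 forall_3_from_0 matrix_matrix_mult_def sum_3_from_0
        sum_4_from_0 id_over_zero_nth B_def)
  moreover have "b ** P = B ** zero_over_id"
    unfolding vec_eq_iff forall_4_from_0 forall_3_from_0 bP bP' colP
    by (simp add: matrix_matrix_mult_def sum_4_from_0 zero_over_id_nth B_def P_nth r0 r1 r2
        flip: p1_def p2_def)
  ultimately have "act_3 (transpose P) (hypermat_of_slices id_over_zero b) = act_4 B id_hypermat"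
    unfolding vec_eq_iff[of "act_3 _ _"] forall_2_from_0
    by (simp add: act_3_def act_4_def id_hypermat_def)
  moreover have "det B = k * det P"
    by (simp add: B_def det_bordered_upper)
  ultimately show ?thesis using that detP by (simp add: k_def)
qed

text \<open>If \<open>N\<close> is the invertible upper block and \<open>q\<close> the last row of the first slice, then the matrix with
  the rows \<open>(N, 0)\<close> and \<open>(q, 1)\<close> sends the identity above a zero row to that slice.\<close>

lemma act_4_to_slices:
  fixes M :: "'k::field hypermat"
  assumes "det (top_square (M $ 0)) \<noteq> 0"
  obtains B b where "det B \<noteq> 0" "M = act_4 B (hypermat_of_slices id_over_zero b)"
proof -
  define B where "B = bordered (top_square (M $ 0)) 0 (M $ 0 $ 3) 1"
  have detB: "det B \<noteq> 0" using assms by (simp add: B_def det_bordered_lower)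
  then obtain B' where B': "B ** B' = mat 1"
    by (metis invertible_def invertible_det_nz)
  have "B ** id_over_zero = M $ 0"
    by (simp add: vec_eq_iff forall_4_from_0 forall_3_from_0 matrix_matrix_mult_def
        sum_4_from_0 id_over_zero_nth B_def)
  moreover have "B ** (B' ** M $ 1) = M $ 1"
    by (simp add: matrix_mul_assoc B')
  ultimately have "M = act_4 B (hypermat_of_slices id_over_zero (B' ** M $ 1))"
    unfolding vec_eq_iff[of M] forall_2_from_0 by (simp add: act_4_def)
  then show ?thesis using that detB by blast
qed

section \<open>Relative invariants are powers of the explicit determinant\<close>

text \<open>Otherwise every nonzero \<open>t\<close> would be a root of unity of the same order.\<close>

lemma power_int_exponent_unique:
  fixes a b :: int
  assumes "infinite (UNIV :: 'k::field set)" and eq: "\<And>t :: 'k. t \<noteq> 0 \<Longrightarrow> t powi a = t powi b"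
  shows "a = b"
proof (rule ccontr)
  assume "a \<noteq> b"
  define n where "n = nat \<bar>a - b\<bar>"
  have "n > 0" using \<open>a \<noteq> b\<close> by (simp add: n_def)
  have root: "t ^ n = 1" if "t \<noteq> 0" for t :: 'k
  proof -
    have "t powi (a - b) = 1" "t powi (b - a) = 1"
      using eq[OF that] that by (simp_all add: power_int_diff)
    moreover have "t ^ n = t powi (a - b) \<or> t ^ n = t powi (b - a)"
      by (cases "a \<ge> b") (simp_all add: n_def power_int_def)
    ultimately show ?thesis by auto
  qed
  define p :: "'k poly" where "p = Polynomial.monom 1 n - 1"
  have "Polynomial.coeff p n = 1" using \<open>n > 0\<close> by (simp add: p_def)
  then have "p \<noteq> 0" by auto
  then have "finite (insert 0 {t. poly p t = 0})" by (simp add: poly_roots_finite)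
  then obtain t where "t \<notin> insert 0 {t. poly p t = 0}"
    using ex_new_if_finite[OF assms(1)] by blast
  then show False using root[of t] by (simp add: p_def poly_monom)
qed

text \<open>A scalar of \<open>GL_3\<close> and the same scalar of \<open>GL_4\<close> act alike, which relates the two weights. On
  \<open>(I, b)\<close> the move to \<open>id_hypermat\<close> has determinants \<open>- k^2\<close> and \<open>- k^3\<close> with \<open>k = krylov_det b\<close>,
  so the value there is \<open>((- k^3)^3 / (- k^2)^4) powi m = (- k) powi m\<close>.\<close>

lemma relative_invariant_eq_power_hyperdet:
  fixes F :: "'k::field hypermat \<Rightarrow> 'k"
  assumes inf: "infinite (UNIV :: 'k set)"
    and F3: "\<And>A M. invertible A \<Longrightarrow> F (act_3 A M) = det A powi l3 * F M"
    and F4: "\<And>B M. invertible B \<Longrightarrow> F (act_4 B M) = det B powi l4 * F M"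
    and F_id: "F id_hypermat = 1"
  obtains m :: int
  where "\<And>M. det (top_square (M $ 0)) \<noteq> 0 \<Longrightarrow> hyperdet M \<noteq> 0 \<Longrightarrow> F M = hyperdet M powi m"
proof -
  have "3 * l3 = 4 * l4"
  proof (rule power_int_exponent_unique[OF inf])
    fix t :: 'k assume t: "t \<noteq> 0"
    have det: "det (mat t :: 'k ^ 3 ^ 3) = t ^ 3" "det (mat t :: 'k ^ 4 ^ 4) = t ^ 4"
      by (simp_all add: det_diagonal mat_def)
    have "act_3 (mat t) id_hypermat = act_4 (mat t) (id_hypermat :: 'k hypermat)"
      by (simp add: act_3_def act_4_def vec_eq_iff matrix_matrix_mult_def mat_def transpose_def
          if_distrib if_distribR mult.commute cong: if_cong)
    then have "det (mat t :: 'k ^ 3 ^ 3) powi l3 = det (mat t :: 'k ^ 4 ^ 4) powi l4"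
      using F3[of "mat t" id_hypermat] F4[of "mat t" id_hypermat] t
      by (simp add: invertible_det_nz det F_id)
    then show "t powi (3 * l3) = t powi (4 * l4)"
      by (simp add: det power_int_mult)
  qed
  then obtain m where m: "l3 = 4 * m" "l4 = 3 * m"
    by (intro that[of "l4 div 3"]) presburger+
  have slices: "F (hypermat_of_slices id_over_zero b) = hyperdet_expansion b powi m"
    if "hyperdet_expansion b \<noteq> 0" for b
  proof -
    define k where "k = krylov_det b"
    have k: "k \<noteq> 0" "hyperdet_expansion b = - k"
      using that by (simp_all add: hyperdet_expansion_eq_krylov k_def)
    obtain P B where
      act: "act_3 (transpose P) (hypermat_of_slices id_over_zero b) = act_4 B id_hypermat"
      and detP: "det P = - (k ^ 2)" and detB: "det B = k * det P"
      using slices_to_id_hypermat[of b] k by (auto simp: k_def)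
    have inv: "invertible (transpose P)" "invertible B"
      using k by (simp_all add: invertible_det_nz detP detB)
    have "(- (k ^ 2)) powi (4 * m) * F (hypermat_of_slices id_over_zero b) =
        (k * (- (k ^ 2))) powi (3 * m)"
      using F3[OF inv(1), of "hypermat_of_slices id_over_zero b"] F4[OF inv(2), of id_hypermat] act
      by (simp add: m detP detB F_id)
    moreover have "(- (k ^ 2)) powi (4 * m) = (k ^ 8) powi m"
      unfolding power_int_mult by (simp flip: power_mult)
    moreover have "(k * (- (k ^ 2))) powi (3 * m) = (k ^ 8 * (- k)) powi m"
      unfolding power_int_mult by (simp add: eval_nat_numeral mult.assoc)
    ultimately have "(k ^ 8) powi m * F (hypermat_of_slices id_over_zero b) =
        (k ^ 8) powi m * (- k) powi m"
      by (simp only: power_int_mult_distrib)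
    then show ?thesis using k by simp
  qed
  have "F M = hyperdet M powi m"
    if top: "det (top_square (M $ 0)) \<noteq> 0" and nz: "hyperdet M \<noteq> 0" for M
  proof -
    obtain B b where B: "det B \<noteq> 0" and M: "M = act_4 B (hypermat_of_slices id_over_zero b)"
      using act_4_to_slices[OF top] .
    have hyperdet_M: "hyperdet M = det B ^ 3 * hyperdet_expansion b"
      by (simp add: M hyperdet_act_4[OF B] hyperdet_slices)
    then have "F M = det B powi (3 * m) * hyperdet_expansion b powi m"
      using nz by (simp add: M F4 invertible_det_nz B slices m)
    then show ?thesis
      by (simp add: hyperdet_M power_int_mult_distrib power_int_mult)
  qed
  then show ?thesis using that by blast
qed

section \<open>The explicit determinant as a polynomial\<close>

lemma (in comm_ring_map) map_hypermat_eval: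
  "h (hypermat_eval g P M) = hypermat_eval (h \<circ> g) P (\<chi> p i j. h (M $ p $ i $ j))"
  by (simp add: hypermat_eval_def mpoly_eval_def map_sum map_mult map_prod map_power case_prod_unfold)

lemma (in comm_ring_map) map_minor_coeff:
  "h (minor_coeff M k (axis i 1)) = minor_coeff (\<chi> p i j. h (M $ p $ i $ j)) k (axis i 1)"
proof -
  have "h (det (cols4 (column 0 (M $ p)) (column 1 (M $ q)) (column 2 (M $ s)) (axis i 1))) =
    det (cols4 (column 0 (\<chi> i j. h (M $ p $ i $ j))) (column 1 (\<chi> i j. h (M $ q $ i $ j)))
      (column 2 (\<chi> i j. h (M $ s $ i $ j))) (axis i 1))" for p q s
    unfolding map_det by (rule arg_cong[of _ _ det])
      (simp add: vec_eq_iff cols4_def column_def axis_def map_zero map_one)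
  then show ?thesis by (simp add: minor_coeff_def map_add Let_def)
qed

lemma (in comm_ring_map) map_hyperdet:
  "h (hyperdet M) = hyperdet (\<chi> p i j. h (M $ p $ i $ j))"
  by (simp add: hyperdet_def map_det minor_matrix_def map_minor_coeff)

text \<open>At this hypermatrix \<open>hyperdet\<close> is itself a polynomial, because it is defined over every
  commutative ring.\<close>

definition generic_hypermat :: "'a::comm_ring_1 hypermat_poly hypermat" where
  "generic_hypermat = (\<chi> p i j. mvar (p, i, j))"

lemma (in comm_ring_map) hypermat_eval_generic:
  "(\<chi> p i j. hypermat_eval h (generic_hypermat $ p $ i $ j) M) = M"
  by (simp add: generic_hypermat_def hypermat_eval_def mpoly_eval_mvar)

lemma (in comm_ring_map) comm_ring_map_hypermat_eval:
  "comm_ring_map (\<lambda>P. hypermat_eval h P M)"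
  unfolding hypermat_eval_def by (rule comm_ring_map_mpoly_eval)

lemma (in comm_ring_map) hypermat_eval_hyperdet:
  "hypermat_eval h (hyperdet generic_hypermat) M = hyperdet M"
  using comm_ring_map.map_hyperdet[OF comm_ring_map_hypermat_eval, of generic_hypermat M]
  by (simp add: hypermat_eval_generic)

lemma (in comm_ring_map) hypermat_eval_det_top:
  "hypermat_eval h (det (top_square (generic_hypermat $ 0))) M = det (top_square (M $ 0))"
proof -
  have "hypermat_eval h (det (top_square (generic_hypermat $ 0))) M =
      det (top_square ((\<chi> p i j. hypermat_eval h (generic_hypermat $ p $ i $ j) M) $ 0))"
    unfolding comm_ring_map.map_det[OF comm_ring_map_hypermat_eval]
    by (rule arg_cong[of _ _ det]) (simp add: vec_eq_iff top_square_def)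
  then show ?thesis by (simp add: hypermat_eval_generic)
qed

lemma hyperdet_id: "hyperdet (id_hypermat :: 'r::comm_ring_1 hypermat) = 1"
  unfolding id_hypermat_def hyperdet_slices
  by (simp add: hyperdet_expansion_def zero_over_id_nth)

lemma hyperdet_zero: "hyperdet (0 :: 'r::comm_ring_1 hypermat) = 0"
  by (simp add: hyperdet_def minor_matrix_def minor_coeff_def det_4_from_0 column_def)

lemma det_top_id: "det (top_square (id_hypermat $ 0 :: 'r::comm_ring_1 ^ 3 ^ 4)) = 1"
  by (simp add: id_hypermat_def det_3_from_0 id_over_zero_nth)

section \<open>Identification of the hyperdeterminant\<close>

text \<open>Invariance and normalization give \<open>D = hyperdet ^ m\<close>; irreducibility forces \<open>m = 1\<close>. The vanishing
  of \<open>hyperdet\<close> at the zero hypermatrix shows that \<open>hyperdet\<close> is not a unit.\<close>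

lemma hyperdeterminant_eq_hyperdet:
  fixes D :: "'a::field hypermat_poly"
  assumes "is_hyperdeterminant D"
  shows "D = hyperdet generic_hypermat"
proof -
  let ?E = "hyperdet generic_hypermat :: 'a hypermat_poly"
  let ?N = "det (top_square (generic_hypermat $ 0)) :: 'a hypermat_poly"
  define F where "F M = hypermat_eval to_ac D M" for M :: "'a alg_closure hypermat"
  interpret comm_ring_map "to_ac :: 'a \<Rightarrow> 'a alg_closure" by (rule comm_ring_map_to_ac)
  interpret ev: comm_ring_map "\<lambda>P. hypermat_eval to_ac P M" for M :: "'a alg_closure hypermat"
    by (rule comm_ring_map_hypermat_eval)
  obtain l3 l4 :: int where
    irr: "Factorial_Ring.irreducible D"
    and F3: "\<And>A M. invertible A \<Longrightarrow> F (act_3 A M) = det A powi l3 * F M"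
    and F4: "\<And>B M. invertible B \<Longrightarrow> F (act_4 B M) = det B powi l4 * F M"
    and D_id: "hypermat_eval id D id_hypermat = 1"
    using assms unfolding is_hyperdeterminant_def F_def by blast
  have inf: "infinite (UNIV :: 'a alg_closure set)"
    by (rule infinite_UNIV_alg_closed_field)
  have "(\<chi> p i j. to_ac ((id_hypermat :: 'a hypermat) $ p $ i $ j)) = id_hypermat"
    by (simp add: vec_eq_iff id_hypermat_def hypermat_of_slices_def id_over_zero_nth zero_over_id_nth)
  then have "F id_hypermat = 1"
    using map_hypermat_eval[of id D id_hypermat] D_id by (simp add: F_def)
  then obtain m where m: "\<And>M. det (top_square (M $ 0)) \<noteq> 0 \<Longrightarrow> hyperdet M \<noteq> 0 \<Longrightarrow>
      F M = hyperdet M powi m"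
    using relative_invariant_eq_power_hyperdet[OF inf F3 F4] by blast
  \<comment> \<open>A polynomial that vanishes wherever \<open>?E\<close> and \<open>?N\<close> do not is zero, since \<open>?E * ?N\<close> is not the zero polynomial.\<close>
  have generic_zero: "P = 0"
    if P: "\<And>M :: 'a alg_closure hypermat. F M = hyperdet M powi m \<Longrightarrow> hyperdet M \<noteq> 0 \<Longrightarrow>
      hypermat_eval to_ac P M = 0" for P :: "'a hypermat_poly"
  proof (rule ccontr)
    assume "P \<noteq> 0"
    have "hypermat_eval to_ac (?E * ?N) id_hypermat = 1"
      by (simp add: ev.map_mult hypermat_eval_hyperdet hypermat_eval_det_top hyperdet_id det_top_id)
    then have "?E * ?N \<noteq> 0"
      using ev.map_zero by (metis zero_neq_one)
    then obtain x where x: "mpoly_eval to_ac x P \<noteq> 0" "mpoly_eval to_ac x (?E * ?N) \<noteq> 0"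
      using common_nonzero_point[OF comm_ring_map_to_ac inj_to_ac inf \<open>P \<noteq> 0\<close>] by blast
    define M where "M = (\<chi> p i j. x (p, i, j))"
    have eval_M: "hypermat_eval to_ac Q M = mpoly_eval to_ac x Q" for Q
    proof -
      have "(\<lambda>(p, i, j). M $ p $ i $ j) = x" by (auto simp: M_def)
      then show ?thesis by (simp add: hypermat_eval_def)
    qed
    have "hyperdet M \<noteq> 0" "det (top_square (M $ 0)) \<noteq> 0"
      using x(2) by (simp_all add: ev.map_mult hypermat_eval_hyperdet hypermat_eval_det_top flip: eval_M)
    then have "hypermat_eval to_ac P M = 0" by (intro P m)
    then show False using x(1) by (simp add: eval_M)
  qed
  have E_not_unit: "\<not> ?E dvd 1"
  proof
    assume "?E dvd 1"
    then obtain Q where "1 = ?E * Q" by (rule dvdE)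
    then have "hypermat_eval to_ac 1 0 = hypermat_eval to_ac (?E * Q) 0"
      by (rule arg_cong)
    then show False
      by (simp add: ev.map_mult ev.map_one hypermat_eval_hyperdet hyperdet_zero)
  qed
  have D_not_unit: "\<not> D dvd 1"
    using irr by (simp add: Factorial_Ring.irreducible_def)
  define n where "n = nat \<bar>m\<bar>"
  have "m \<ge> 0"
  proof (rule ccontr)
    assume "\<not> m \<ge> 0"
    then have "m = - int n" by (simp add: n_def)
    have "D * ?E ^ n - 1 = 0"
      by (rule generic_zero)
        (simp add: ev.map_diff ev.map_mult ev.map_power ev.map_one hypermat_eval_hyperdet
          \<open>m = - int n\<close> power_int_minus flip: F_def)
    then have "1 = D * ?E ^ n" by simp
    then have "D dvd 1" by (rule dvdI)
    then show False using D_not_unit by blast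
  qed
  then have "m = int n" by (simp add: n_def)
  have "D - ?E ^ n = 0"
    by (rule generic_zero)
      (simp add: ev.map_diff ev.map_power hypermat_eval_hyperdet \<open>m = int n\<close> flip: F_def)
  then have D: "D = ?E ^ n" by simp
  have "n \<noteq> 0" using D D_not_unit by (cases n) auto
  then obtain n' where n': "n = Suc n'" by (cases n) auto
  have "?E dvd 1 \<or> ?E ^ n' dvd 1"
    using Factorial_Ring.irreducibleD[OF irr, of ?E "?E ^ n'"] by (simp add: D n')
  moreover have "?E dvd 1" if "?E ^ n' dvd 1" "n' \<noteq> 0"
    using that by (meson dvd_power dvd_trans bot_nat_0.not_eq_extremum)
  ultimately have "n' = 0" using E_not_unit by blast
  then show ?thesis by (simp add: D n')
qed

theorem theorem3p7:
  fixes D :: "'a::field hypermat_poly"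
  assumes "is_hyperdeterminant D"
  shows "(\<forall>b :: 'a ^ 3 ^ 4.
            hypermat_eval id D (hypermat_of_slices id_over_zero b) = hyperdet_expansion b) \<and>
         (let b = (\<chi> i j. mvar (i, j)) :: (4 \<times> 3, 'a) mpolynomial ^ 3 ^ 4
          in hypermat_eval mconst D (hypermat_of_slices id_over_zero b) = hyperdet_expansion b)"
  unfolding Let_def hyperdeterminant_eq_hyperdet[OF assms]
  by (simp only: comm_ring_map.hypermat_eval_hyperdet[OF comm_ring_map_id]
      comm_ring_map.hypermat_eval_hyperdet[OF comm_ring_map_mconst] hyperdet_slices simp_thms)

end
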